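(* For all $d,k,n\in\mathbb{N}$, every $n$-vertex graph $G$ with $\mathrm{tw}(G)\le k$ is contained in $H\boxtimes K_m$ for some graph $H$ with $\mathrm{td}(H)\le d$ and some integer $m\le (k+1)^{1-1/d}n^{1/d}$.
   Context: $\mathrm{tw}$ denotes tree-width. The tree-depth $\mathrm{td}(H)$ is the minimum number of vertices on a longest root-to-leaf path of a rooted forest $F$ such that $H$ is a subgraph of the closure of $F$ (the graph joining every ancestor–descendant pair of $F$). The strong product $A\boxtimes B$ has vertex set $V(A)\times V(B)$, with distinct $(v,x),(w,y)$ adjacent iff ($v=w$ and $xy\in E(B)$) or ($x=y$ and $vw\in E(A)$) or ($vw\in E(A)$ and $xy\in E(B)$). Contained means isomorphic to a subgraph. *)

theory Defs
  imports Complex_Main "Graph_Theory.Graph_Theory"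
begin

text \<open>
  Finite simple graphs are symmetric loop-free digraphs without parallel arcs, that is, values
  of type \<^typ>\<open>'a pair_pre_digraph\<close> satisfying \<^const>\<open>pair_graph\<close>; an undirected edge is a pair
  of opposite arcs.
\<close>

definition contained_in :: "'a pair_pre_digraph \<Rightarrow> 'b pair_pre_digraph \<Rightarrow> bool" where
  "contained_in G X \<longleftrightarrow>
     (\<exists>S :: 'b pair_pre_digraph. subgraph (with_proj S) (with_proj X)
        \<and> digraph_iso (with_proj G) (with_proj S))"

definition complete_graph :: "nat \<Rightarrow> nat pair_pre_digraph" where
  "complete_graph m = \<lparr> pverts = {..<m}, parcs = {(x, y). x < m \<and> y < m \<and> x \<noteq> y} \<rparr>"

definition strong_product ::
    "'a pair_pre_digraph \<Rightarrow> 'b pair_pre_digraph \<Rightarrow> ('a \<times> 'b) pair_pre_digraph"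
    (infixl "\<boxtimes>" 70) where
  "A \<boxtimes> B = \<lparr> pverts = pverts A \<times> pverts B,
     parcs = {((v, x), (w, y)).
       (v, x) \<in> pverts A \<times> pverts B \<and> (w, y) \<in> pverts A \<times> pverts B \<and> (v, x) \<noteq> (w, y) \<and>
       (v = w \<and> (x, y) \<in> parcs B \<or>
        x = y \<and> (v, w) \<in> parcs A \<or>
        (v, w) \<in> parcs A \<and> (x, y) \<in> parcs B)} \<rparr>"


subsection \<open>Tree-width\<close>

text \<open>
  The constants \<^const>\<open>forest\<close> and \<^const>\<open>tree\<close> of the library only exclude directed cycles, and in a
  symmetric digraph each edge \<open>ab\<close> gives the \<^const>\<open>pre_digraph.cycle\<close> \<open>a, b, a\<close>. The cycles of
  the undirected graph are those with at least three arcs.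
\<close>

definition undirected_tree :: "'t pair_pre_digraph \<Rightarrow> bool" where
  "undirected_tree T \<longleftrightarrow> pair_graph T \<and> connected (with_proj T) \<and>
     \<not> (\<exists>p. pre_digraph.cycle (with_proj T) p \<and> 3 \<le> length p)"

text \<open>
  In the last condition below, \<^const>\<open>connected\<close> includes that the set of nodes is not empty.
\<close>

definition tree_decomposition ::
    "'a pair_pre_digraph \<Rightarrow> 't pair_pre_digraph \<Rightarrow> ('t \<Rightarrow> 'a set) \<Rightarrow> bool" where
  "tree_decomposition G T B \<longleftrightarrow>
     undirected_tree T \<and>
     (\<Union>t\<in>pverts T. B t) = pverts G \<and>
     (\<forall>(u, v)\<in>parcs G. \<exists>t\<in>pverts T. u \<in> B t \<and> v \<in> B t) \<and>
     (\<forall>v\<in>pverts G. connected (with_proj T \<restriction> {t \<in> pverts T. v \<in> B t}))"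

text \<open>
  The subtraction is truncated, so the graph without vertices gets tree-width \<open>0\<close>.
\<close>

definition decomposition_width :: "'t pair_pre_digraph \<Rightarrow> ('t \<Rightarrow> 'a set) \<Rightarrow> nat" where
  "decomposition_width T B = Max ((\<lambda>t. card (B t)) ` pverts T) - 1"

text \<open>
  Every finite tree is isomorphic to one whose nodes are natural numbers, so it is no
  restriction to index decompositions by such trees.
\<close>

definition treewidth :: "'a pair_pre_digraph \<Rightarrow> nat" where
  "treewidth G = (LEAST w. \<exists>(T :: nat pair_pre_digraph) B.
     tree_decomposition G T B \<and> w = decomposition_width T B)"


subsection \<open>Tree-depth\<close>

text \<open>
  A rooted forest is represented with its arcs directed from parent to child. It is then an
  acyclic digraph (\<^const>\<open>forest\<close>) in which every vertex has at most one parent, the ancestors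
  of a vertex are the vertices from which it is reachable, and every directed path is part of a
  root-to-leaf path.
\<close>

definition rooted_forest :: "'a pair_pre_digraph \<Rightarrow> bool" where
  "rooted_forest F \<longleftrightarrow> pair_digraph F \<and> forest (with_proj F) \<and>
     (\<forall>v\<in>pverts F. in_degree (with_proj F) v \<le> 1)"

definition forest_roots :: "'a pair_pre_digraph \<Rightarrow> 'a set" where
  "forest_roots F = {v \<in> pverts F. in_degree (with_proj F) v = 0}"

definition forest_leaves :: "'a pair_pre_digraph \<Rightarrow> 'a set" where
  "forest_leaves F = {v \<in> pverts F. out_degree (with_proj F) v = 0}"

text \<open>
  The supremum of the empty set of natural numbers is \<open>0\<close>, which is the height of the forest
  without vertices.
\<close>

definition forest_height :: "'a pair_pre_digraph \<Rightarrow> nat" where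
  "forest_height F = Sup {length (pre_digraph.awalk_verts (with_proj F) r p) | r p l.
     r \<in> forest_roots F \<and> l \<in> forest_leaves F \<and> pre_digraph.apath (with_proj F) r p l}"

definition forest_closure :: "'a pair_pre_digraph \<Rightarrow> 'a pair_pre_digraph" where
  "forest_closure F = \<lparr> pverts = pverts F,
     parcs = {(u, v). u \<in> pverts F \<and> v \<in> pverts F \<and> u \<noteq> v \<and>
       (u \<rightarrow>\<^sup>*\<^bsub>with_proj F\<^esub> v \<or> v \<rightarrow>\<^sup>*\<^bsub>with_proj F\<^esub> u)} \<rparr>"

definition treedepth :: "'a pair_pre_digraph \<Rightarrow> nat" where
  "treedepth H = (LEAST h. \<exists>F :: 'a pair_pre_digraph.
     rooted_forest F \<and> subgraph (with_proj H) (with_proj (forest_closure F)) \<and>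
     h = forest_height F)"

end

theory Submission
  imports Defs "HOL-Library.Sublist" "HOL-Library.Countable"
begin

text \<open>
  Let \<open>x\<close> be the required bound on \<open>m\<close>, so that \<open>x ^ d = (k + 1) ^ (d - 1) * n\<close>.
  Deleting \<open>q = \<lfloor>x / (k + 1)\<rfloor>\<close> suitable bags of a tree-decomposition removes at most
  \<open>x\<close> vertices and leaves components of at most \<open>n / (q + 1) \<le> n (k + 1) / x\<close>
  vertices. For graphs of that size the bound for \<open>d - 1\<close> is again \<open>x\<close>, so by induction on \<open>d\<close> each
  component lies in a product whose first factor has tree-depth at most \<open>d - 1\<close>; the deleted
  vertices become a common root. The vertices of the first factor are lists of length less than
  \<open>d\<close>, with the prefix order as the ancestor relation.
\<close>

subsection \<open>Separators\<close>

text \<open>A tree on all natural numbers with root \<open>0\<close>. Numbers decrease towards the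
  root, which rules out cycles and allows strong induction along paths.\<close>

locale parent_order =
  fixes p :: "nat \<Rightarrow> nat"
  assumes parent_less: "0 < i \<Longrightarrow> p i < i"
begin

inductive anc :: "nat \<Rightarrow> nat \<Rightarrow> bool" where
  anc_refl: "anc i i"
| anc_step: "0 < i \<Longrightarrow> anc a (p i) \<Longrightarrow> anc a i"

lemma anc_le: "anc a b \<Longrightarrow> a \<le> b"
  by (induction rule: anc.induct) (auto dest: parent_less)

lemma anc_trans: "anc b c \<Longrightarrow> anc a b \<Longrightarrow> anc a c"
  by (induction rule: anc.induct) (auto intro: anc_step)

text \<open>Both paths end in \<open>c\<close> and parents are unique, so they can be traced upwards
  together until the shorter one ends.\<close>

lemma anc_chain: "anc a c \<Longrightarrow> anc b c \<Longrightarrow> anc a b \<or> anc b a"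
proof (induction rule: anc.induct)
  case (anc_step i a)
  from \<open>anc b i\<close> show ?case
    by cases (use anc_step anc.anc_step in auto)
qed auto

lemma anc_zero: "anc 0 i"
proof (induction i rule: less_induct)
  case (less i)
  then show ?case
    by (cases "i = 0") (auto intro: anc_refl anc_step parent_less)
qed

lemma anc_child:
  assumes "anc t i" "t \<noteq> i"
  obtains c where "0 < c" "p c = t" "anc c i"
proof -
  from assms have "\<exists>c>0. p c = t \<and> anc c i"
    by (induction rule: anc.induct) (metis anc.simps)+
  with that show thesis by blast
qed

text \<open>As ancestors of \<open>i\<close> the two nodes are comparable. If they differed, the
  upper one would be an ancestor of the parent of the lower one, which is also its own parent and
  has a smaller number.\<close>

lemma anc_child_unique:
  assumes "anc c i" "anc c' i" "p c = p c'" "0 < c" "0 < c'"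
  shows "c = c'"
proof -
  have *: "a = b" if "anc a b" "p a = p b" "0 < a" "0 < b" for a b
    using that(1)
  proof cases
    case anc_step
    then show ?thesis using anc_le[of a "p b"] parent_less[of a] that by simp
  qed simp
  show ?thesis using anc_chain[OF assms(1,2)] *[of c c'] *[of c' c] assms by auto
qed

end

section \<open>Tree-decompositions over such trees\<close>

text \<open>\<open>bag_parent\<close> is the connectedness axiom in a form suited to climbing: while
  some bag of smaller number contains the vertex, a step to the parent stays within its
  bags.\<close>

locale ordered_decomposition = parent_order p
  for p :: "nat \<Rightarrow> nat" +
  fixes B :: "nat \<Rightarrow> 'a set" and E :: "'a rel"
  assumes bag_parent: "v \<in> B i \<Longrightarrow> v \<in> B j \<Longrightarrow> j < i \<Longrightarrow> v \<in> B (p i)"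
    and edge_bag: "(u, v) \<in> E \<Longrightarrow> \<exists>i. u \<in> B i \<and> v \<in> B i"
begin

text \<open>The root of the subtree of bags containing \<open>v\<close>, as \<open>anc_top\<close>
  confirms. It assigns each vertex to a single node, so that subtrees can be weighed.\<close>

definition top :: "'a \<Rightarrow> nat" where "top v = (LEAST i. v \<in> B i)"

lemma top_le: "v \<in> B i \<Longrightarrow> top v \<le> i"
  unfolding top_def by (rule Least_le)

lemma top_in: "v \<in> B i \<Longrightarrow> v \<in> B (top v)"
  unfolding top_def by (rule LeastI)

text \<open>Climbing from \<open>i\<close>, \<open>bag_parent\<close> with \<open>j = top v\<close>
  keeps \<open>v\<close> in the bag until \<open>top v\<close> is reached.\<close>

lemma anc_top: "v \<in> B i \<Longrightarrow> anc (top v) i"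
proof (induction i rule: less_induct)
  case (less i)
  show ?case
  proof (cases "top v = i")
    case False
    with less.prems have "top v < i" using top_le by fastforce
    then have "v \<in> B (p i)" using bag_parent top_in less.prems by blast
    with \<open>top v < i\<close> show ?thesis by (metis anc_step gr_implies_not0 less.IH neq0_conv parent_less)
  qed (simp add: anc_refl)
qed

lemma bag_between: "v \<in> B i \<Longrightarrow> anc j i \<Longrightarrow> anc (top v) j \<Longrightarrow> v \<in> B j"
proof (induction i rule: less_induct)
  case (less i)
  from \<open>anc j i\<close> show ?case
  proof cases
    case anc_step
    then have "j < i" using anc_le[of j "p i"] parent_less[of i] by linarith
    then have "top v < i" using anc_le[OF less.prems(3)] by linarith
    then have "v \<in> B (p i)" using bag_parent top_in less.prems by blast
    then show ?thesis using anc_step less.prems(3) by (intro less.IH[of "p i"] parent_less) auto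
  qed (use less in simp)
qed

lemma edge_top:
  assumes "(u, v) \<in> E"
  shows "anc (top u) (top v) \<or> anc (top v) (top u)"
  using edge_bag[OF assms] anc_chain anc_top by blast

text \<open>A bag containing both ends lies below \<open>top v\<close>, hence below
  \<open>j\<close>, while \<open>top u\<close> lies above \<open>j\<close>. So the bag at
  \<open>j\<close> meets every edge that passes \<open>j\<close>.\<close>

lemma edge_bag_between:
  assumes "(u, v) \<in> E \<or> (v, u) \<in> E" "anc (top u) j" "anc j (top v)"
  shows "u \<in> B j"
  using edge_bag assms bag_between anc_top anc_trans by meson

text \<open>The lowest node whose subtree carries more than \<open>c\<close> vertices cuts off pieces of size at most
  \<open>c\<close>; what lies outside the subtree has lost more than \<open>c\<close> vertices, at the price of one bag.\<close>
lemma separator: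
  fixes c :: real
  assumes bag_card: "\<And>i. finite (B i) \<and> card (B i) \<le> K" and "0 \<le> c"
    and "finite W" "W \<subseteq> (\<Union>i. B i)" "card W \<le> (real q + 1) * c"
  obtains S and f :: "'a \<Rightarrow> nat" where "S \<subseteq> W" "card S \<le> q * K"
    "\<And>u v. u \<in> W - S \<Longrightarrow> v \<in> W - S \<Longrightarrow> (u, v) \<in> E \<Longrightarrow> f u = f v"
    "\<And>a. card {v \<in> W - S. f v = a} \<le> c"
proof -
  from assms(3-5)
  have "\<exists>S (f :: 'a \<Rightarrow> nat). S \<subseteq> W \<and> card S \<le> q * K \<and>
    (\<forall>u\<in>W - S. \<forall>v\<in>W - S. (u, v) \<in> E \<longrightarrow> f u = f v) \<and>
    (\<forall>a. card {v \<in> W - S. f v = a} \<le> c)"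
  proof (induction q arbitrary: W)
    case 0
    have "card {v \<in> W. a = 0} \<le> c" for a :: nat
      using 0 \<open>0 \<le> c\<close> by (cases "a = 0") auto
    then show ?case by (intro exI[of _ "{}"] exI[of _ "\<lambda>_. 0"]) (auto simp: eq_commute[of 0])
  next
    case (Suc q)
    \<comment> \<open>The weight of the subtree at \<open>t\<close> counts the vertices of
      \<open>W\<close> all of whose bags lie in it.\<close>
    define D where "D t = {v \<in> W. anc t (top v)}" for t
    have fin: "finite (D t)" for t using Suc.prems by (auto simp: D_def)
    show ?case
    proof (cases "\<exists>t. c < card (D t)")
      case False
      then have "card (D 0) \<le> c" by (simp add: not_less)
      then have "card W \<le> c" using anc_zero by (simp add: D_def)
      then have "card {v \<in> W. a = 0} \<le> c" for a :: nat
        using \<open>0 \<le> c\<close> by (cases "a = 0") auto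
      then show ?thesis by (intro exI[of _ "{}"] exI[of _ "\<lambda>_. 0"]) (auto simp: eq_commute[of 0])
    next
      case True
      \<comment> \<open>There are infinitely many nodes, so \<open>Max\<close> needs finiteness: a
        heavy subtree contains some top node, which bounds the number of its root.\<close>
      have "{t. c < card (D t)} \<subseteq> (\<Union>v\<in>W. {..top v})"
      proof
        fix t assume "t \<in> {t. c < card (D t)}"
        with \<open>0 \<le> c\<close> have "card (D t) \<noteq> 0" by auto
        then have "D t \<noteq> {}" by auto
        then show "t \<in> (\<Union>v\<in>W. {..top v})" using anc_le by (auto simp: D_def)
      qed
      then have finT: "finite {t. c < card (D t)}"
        using Suc.prems by (auto intro: finite_subset)
      \<comment> \<open>Descendants have larger numbers, so below the heavy node of largest number
        all subtrees are light.\<close>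
      define t where "t = Max {t. c < card (D t)}"
      have t: "c < card (D t)" using Max_in[OF finT] True by (auto simp: t_def)
      have below: "card (D s) \<le> c" if "t < s" for s
        using Max_ge[OF finT, of s] that by (force simp: t_def)
      define W' where "W' = W - D t"
      have "card W = card (D t) + card W'"
        using Suc.prems fin by (simp add: W'_def card_Diff_subset card_mono D_def)
      then have "card W' \<le> (real q + 1) * c"
        using Suc.prems t by (simp add: algebra_simps)
      moreover have "finite W'" "W' \<subseteq> (\<Union>i. B i)" using Suc.prems by (auto simp: W'_def)
      ultimately obtain S f where S: "S \<subseteq> W'" "card S \<le> q * K"
        and f: "\<And>u v. u \<in> W' - S \<Longrightarrow> v \<in> W' - S \<Longrightarrow> (u, v) \<in> E \<Longrightarrow> f u = (f v :: nat)"
        and fc: "\<And>a. card {v \<in> W' - S. f v = a} \<le> c"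
        using Suc.IH[of W'] by meson
      \<comment> \<open>Deleting the bag of \<open>t\<close> separates the subtrees at the children
        of \<open>t\<close> from each other and from the rest.\<close>
      define S' where "S' = S \<union> (B t \<inter> W)"
      define child where "child v = (SOME s. 0 < s \<and> p s = t \<and> anc s (top v))" for v
      \<comment> \<open>the parity keeps the new labels apart from those of \<open>f\<close>\<close>
      define g where "g v = (if v \<in> D t then 2 * child v + 1 else 2 * f v)" for v
      have child: "0 < child v \<and> p (child v) = t \<and> anc (child v) (top v)" if "v \<in> D t - S'" for v
      proof -
        \<comment> \<open>A vertex with top node \<open>t\<close> lies in \<open>B t\<close> and is
          deleted, so the remaining top nodes are strictly below \<open>t\<close>.\<close>
        from that Suc.prems obtain i where "v \<in> B i" by (auto simp: D_def)
        with top_in that have "t \<noteq> top v" by (auto simp: D_def S'_def)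
        with that obtain s where "0 < s \<and> p s = t \<and> anc s (top v)"
          by (auto simp: D_def elim: anc_child)
        then show ?thesis unfolding child_def by (rule someI)
      qed
      \<comment> \<open>An edge across the border of the subtree passes \<open>t\<close>, so its
        outer end would lie in the deleted bag.\<close>
      have outside: "anc t (top u) \<longleftrightarrow> anc t (top v)"
        if uv: "u \<in> W - S'" "v \<in> W - S'" "(u, v) \<in> E" for u v
      proof -
        have *: "anc t (top y)"
          if xy: "x \<in> W - S'" "(x, y) \<in> E \<or> (y, x) \<in> E" "anc t (top x)" "y \<in> W - S'" for x y
        proof (rule ccontr)
          assume no: "\<not> anc t (top y)"
          then have "\<not> anc (top x) (top y)" using xy anc_trans by blast
          then have "anc (top y) (top x)" using edge_top xy by blast
          then have "anc (top y) t" using anc_chain[of _ "top x" t] no xy(3) by blast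
          then have "y \<in> B t" using edge_bag_between xy by blast
          then show False using xy by (auto simp: S'_def)
        qed
        show ?thesis using *[of u v] *[of v u] uv by blast
      qed
      have "card S' \<le> Suc q * K"
      proof -
        have "card S' \<le> card S + card (B t \<inter> W)" unfolding S'_def by (rule card_Un_le)
        also have "card (B t \<inter> W) \<le> K"
          using bag_card[of t] card_mono[of "B t" "B t \<inter> W"] by auto
        finally show ?thesis using S by simp
      qed
      moreover have "g u = g v" if uv: "u \<in> W - S'" "v \<in> W - S'" "(u, v) \<in> E" for u v
      proof (cases "u \<in> D t")
        case True
        then have D: "u \<in> D t - S'" "v \<in> D t - S'"
          using outside[OF uv] uv by (auto simp: D_def)
        \<comment> \<open>Top nodes of adjacent vertices are comparable, so both children are
          ancestors of the lower one, and only one child of \<open>t\<close> can be.\<close>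
        then have "anc (child u) (top v) \<and> anc (child v) (top v) \<or>
          anc (child u) (top u) \<and> anc (child v) (top u)"
          using edge_top[OF uv(3)] child anc_trans by meson
        then have "child u = child v" using child D anc_child_unique by metis
        then show ?thesis using D by (simp add: g_def)
      next
        case False
        then have "v \<notin> D t" using outside[OF uv] uv by (auto simp: D_def)
        then show ?thesis using f[of u v] uv False by (auto simp: g_def S'_def W'_def)
      qed
      moreover have "card {v \<in> W - S'. g v = a} \<le> c" for a
      proof (cases "even a")
        case True
        then have "{v \<in> W - S'. g v = a} \<subseteq> {v \<in> W' - S. f v = a div 2}"
          by (auto simp: g_def W'_def S'_def split: if_splits)
        then have "card {v \<in> W - S'. g v = a} \<le> card {v \<in> W' - S. f v = a div 2}"
          using Suc.prems by (intro card_mono) (simp_all add: W'_def)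
        then show ?thesis using fc[of "a div 2"] by linarith
      next
        case odd: False
        have in_child: "v \<in> D t - S'" "child v = a div 2" if "v \<in> W - S'" "g v = a" for v
          using that odd by (auto simp: g_def split: if_splits)
        have sub: "{v \<in> W - S'. g v = a} \<subseteq> D (a div 2)"
        proof
          fix v assume "v \<in> {v \<in> W - S'. g v = a}"
          then show "v \<in> D (a div 2)" using in_child[of v] child[of v] by (simp add: D_def)
        qed
        show ?thesis
        proof (cases "{v \<in> W - S'. g v = a} = {}")
          case True
          then show ?thesis using \<open>0 \<le> c\<close> by (simp only: card.empty of_nat_0)
        next
          case False
          then obtain v where "v \<in> D t - S'" "child v = a div 2" using in_child by blast
          \<comment> \<open>Children of \<open>t\<close> have larger numbers, so their subtrees are
            light by the choice of \<open>t\<close>.\<close>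
          then have "t < a div 2" using child parent_less by metis
          with card_mono[OF fin sub] below show ?thesis by (meson of_nat_mono order_trans)
        qed
      qed
      ultimately show ?thesis using S
        by (intro exI[of _ S'] exI[of _ g]) (auto simp: S'_def W'_def)
    qed
  qed
  then show thesis using that by blast
qed

section \<open>Labelling vertices by lists\<close>

text \<open>A label is a path from the root of the future forest: deleted vertices get the empty
  list, all others the number of their piece followed by an inductively chosen label. The size
  condition is the bound of the theorem for depth \<open>d + 1\<close>, freed of roots.\<close>

lemma list_labelling:
  fixes x :: real
  assumes bag_card: "\<And>i. finite (B i) \<and> card (B i) \<le> K" and "0 < K" "0 \<le> x"
    and "finite W" "W \<subseteq> (\<Union>i. B i)" "card W * real K ^ d \<le> x ^ Suc d"
  shows "\<exists>f :: 'a \<Rightarrow> nat list. (\<forall>v. length (f v) \<le> d) \<and>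
    (\<forall>a. card {v \<in> W. f v = a} \<le> x) \<and>
    (\<forall>u\<in>W. \<forall>v\<in>W. (u, v) \<in> E \<longrightarrow> prefix (f u) (f v) \<or> prefix (f v) (f u))"
  using assms(4-6)
proof (induction d arbitrary: W)
  case 0
  have "card {v \<in> W. a = []} \<le> x" for a :: "nat list"
    using 0 \<open>0 \<le> x\<close> by (cases "a = []") auto
  then show ?case by (intro exI[of _ "\<lambda>_. []"]) (auto simp: eq_commute[of "[]"])
next
  case (Suc d)
  \<comment> \<open>\<open>q\<close> bags contain at most \<open>x\<close> vertices, and
    \<open>c\<close> is the largest size at which a piece meets the size condition for
    \<open>d\<close>. Rounding \<open>x / K\<close> down is harmless because the separator leaves
    room for \<open>(q + 1) * c\<close> vertices.\<close>
  define q where "q = nat \<lfloor>x / K\<rfloor>"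
  define c where "c = x ^ Suc d / real K ^ d"
  have c: "0 \<le> c" using \<open>0 \<le> x\<close> by (simp add: c_def)
  have q: "real q \<le> x / K" "x / K \<le> real q + 1"
    using \<open>0 \<le> x\<close> \<open>0 < K\<close> by (simp_all add: q_def)
  have "card W \<le> (x / K) * c"
    using Suc.prems \<open>0 < K\<close> by (simp add: c_def field_simps)
  also have "\<dots> \<le> (real q + 1) * c" using q c by (intro mult_right_mono) auto
  finally have "card W \<le> (real q + 1) * c" .
  from separator[OF bag_card c Suc.prems(1,2) this]
  obtain S and g :: "'a \<Rightarrow> nat" where S: "S \<subseteq> W" "card S \<le> q * K"
    and g: "\<And>u v. u \<in> W - S \<Longrightarrow> v \<in> W - S \<Longrightarrow> (u, v) \<in> E \<Longrightarrow> g u = g v"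
    and gc: "\<And>a. card {v \<in> W - S. g v = a} \<le> c"
    by blast
  have Sx: "card S \<le> x"
  proof -
    have "real (card S) \<le> real q * K" using S by (metis of_nat_mono of_nat_mult)
    also have "\<dots> \<le> x" using q \<open>0 < K\<close> by (simp add: field_simps)
    finally show ?thesis .
  qed
  define part where "part b = {v \<in> W - S. g v = b}" for b
  define good where "good b f \<longleftrightarrow> (\<forall>v. length (f v) \<le> d) \<and>
    (\<forall>a. card {v \<in> part b. f v = a} \<le> x) \<and>
    (\<forall>u\<in>part b. \<forall>v\<in>part b. (u, v) \<in> E \<longrightarrow> prefix (f u) (f v) \<or> prefix (f v) (f u))"
    for b and f :: "'a \<Rightarrow> nat list"
  have "\<exists>f. good b f" for b
    unfolding good_def
  proof (rule Suc.IH)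
    show "card (part b) * real K ^ d \<le> x ^ Suc d"
      using gc[of b] \<open>0 < K\<close> by (simp add: c_def part_def field_simps)
  qed (use Suc.prems in \<open>auto simp: part_def\<close>)
  then obtain F where F: "\<And>b. good b (F b)" by metis
  \<comment> \<open>The empty list is a prefix of every list, so deleted vertices are comparable to
    all others; adjacent survivors share their head since \<open>g\<close> is constant along
    edges.\<close>
  define f where "f v = (if v \<in> S then [] else g v # F (g v) v)" for v
  have "card {v \<in> W. f v = a} \<le> x" for a
  proof (cases a)
    case Nil
    then have "{v \<in> W. f v = a} = S" using S by (auto simp: f_def)
    then show ?thesis using Sx by simp
  next
    case (Cons b a')
    then have "{v \<in> W. f v = a} = {v \<in> part b. F b v = a'}" by (auto simp: f_def part_def)
    then show ?thesis using F[of b] by (simp add: good_def)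
  qed
  moreover have "prefix (f u) (f v) \<or> prefix (f v) (f u)"
    if "u \<in> W" "v \<in> W" "(u, v) \<in> E" for u v
  proof (cases "u \<in> S \<or> v \<in> S")
    case False
    with that g have "g u = g v" "u \<in> part (g u)" "v \<in> part (g u)" by (auto simp: part_def)
    with F[of "g u"] \<open>(u, v) \<in> E\<close>
    have "prefix (F (g u) u) (F (g u) v) \<or> prefix (F (g u) v) (F (g u) u)"
      unfolding good_def by blast
    with False \<open>g u = g v\<close> show ?thesis by (simp add: f_def)
  qed (auto simp: f_def)
  ultimately show ?case using F by (intro exI[of _ f]) (auto simp: f_def good_def)
qed

end

subsection \<open>Ordering a tree-decomposition\<close>

lemma rtrancl_crossing:
  assumes "(a, b) \<in> R\<^sup>*" "a \<in> X" "b \<notin> X"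
  obtains x y where "(x, y) \<in> R" "x \<in> X" "y \<notin> X"
proof -
  from assms have "\<exists>x y. (x, y) \<in> R \<and> x \<in> X \<and> y \<notin> X"
    by (induction rule: rtrancl_induct) auto
  with that show thesis by blast
qed

text \<open>A walk from a listed vertex to an unlisted one has an arc that leaves the list, and the
  end of this arc can be appended.\<close>

lemma search_order:
  assumes "finite V" "V \<noteq> {}" "E \<subseteq> V \<times> V" and conn: "\<And>u v. u \<in> V \<Longrightarrow> v \<in> V \<Longrightarrow> (u, v) \<in> E\<^sup>*"
  obtains xs where "distinct xs" "set xs = V"
    "\<And>i. 0 < i \<Longrightarrow> i < length xs \<Longrightarrow> \<exists>j<i. (xs ! j, xs ! i) \<in> E"
proof -
  have grow: "\<exists>xs. length xs = Suc n \<and> distinct xs \<and> set xs \<subseteq> V \<and>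
    (\<forall>i. 0 < i \<longrightarrow> i < length xs \<longrightarrow> (\<exists>j<i. (xs ! j, xs ! i) \<in> E))" if "n < card V" for n
    using that
  proof (induction n)
    case 0
    from \<open>V \<noteq> {}\<close> obtain r where "r \<in> V" by blast
    then show ?case by (intro exI[of _ "[r]"]) auto
  next
    case (Suc n)
    then obtain xs where xs: "length xs = Suc n" "distinct xs" "set xs \<subseteq> V"
      "\<And>i. 0 < i \<Longrightarrow> i < length xs \<Longrightarrow> \<exists>j<i. (xs ! j, xs ! i) \<in> E" by auto
    have "card (set xs) < card V" using xs Suc.prems by (simp add: distinct_card)
    then obtain v where v: "v \<in> V" "v \<notin> set xs" using xs(3) by (metis less_irrefl subsetI subset_antisym)
    obtain r where r: "r \<in> set xs" using xs(1) by (cases xs) auto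
    with v xs(3) conn have "(r, v) \<in> E\<^sup>*" by blast
    then obtain a b where ab: "(a, b) \<in> E" "a \<in> set xs" "b \<notin> set xs"
      using r v(2) by (rule rtrancl_crossing)
    then obtain k where k: "k < length xs" "xs ! k = a" by (auto simp: in_set_conv_nth)
    have "\<exists>j<i. ((xs @ [b]) ! j, (xs @ [b]) ! i) \<in> E" if "0 < i" "i < length (xs @ [b])" for i
    proof (cases "i < length xs")
      case True
      with xs(4)[OF \<open>0 < i\<close>] obtain j where "j < i" "(xs ! j, xs ! i) \<in> E" by blast
      with True show ?thesis by (intro exI[of _ j]) (simp add: nth_append)
    next
      case False
      with that have "i = length xs" by simp
      with k ab show ?thesis by (intro exI[of _ k]) (simp add: nth_append)
    qed
    with xs ab assms(3) show ?case by (intro exI[of _ "xs @ [b]"]) auto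
  qed
  have "card V > 0" using assms(1,2) by (simp add: card_gt_0_iff)
  then have "card V - 1 < card V" by simp
  from grow[OF this] obtain xs where xs: "length xs = Suc (card V - 1)" "distinct xs"
    "set xs \<subseteq> V" "\<And>i. 0 < i \<Longrightarrow> i < length xs \<Longrightarrow> \<exists>j<i. (xs ! j, xs ! i) \<in> E"
    by auto
  have "card (set xs) = card V" using xs(1,2) \<open>card V > 0\<close> by (simp add: distinct_card)
  then have "set xs = V" using xs(3) assms(1) by (simp add: card_subset_eq)
  with xs that show thesis by blast
qed

text \<open>\<open>connected\<close> refers to the symmetric closure, which adds no arcs to a
  symmetric graph.\<close>

lemma connected_imp_rtrancl:
  assumes "connected (with_proj T \<restriction> S)" "pair_graph T" "a \<in> S" "b \<in> S"
  shows "(a, b) \<in> (parcs T \<inter> S \<times> S)\<^sup>*"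
proof -
  interpret pair_graph T by fact
  have "a \<rightarrow>\<^sup>*\<^bsub>with_proj (mk_symmetric (with_proj T \<restriction> S))\<^esub> b"
    using assms by (simp add: connected_def strongly_connected_def mk_symmetric_def)
  then have "(a, b) \<in> (parcs (mk_symmetric (with_proj T \<restriction> S)))\<^sup>*"
    using reachable_rtranclI by fastforce
  moreover have "parcs (mk_symmetric (with_proj T \<restriction> S)) \<subseteq> parcs T \<inter> S \<times> S"
    using arcs_symmetric by (auto simp: mk_symmetric_def induce_subgraph_def)
  ultimately show ?thesis using rtrancl_mono by blast
qed

text \<open>A path from \<open>a\<close> to \<open>b\<close> inside \<open>X\<close> avoids
  \<open>x\<close>, so it closes up through \<open>x\<close> to a cycle. If
  \<open>a \<noteq> b\<close>, this cycle has at least three arcs.\<close>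

lemma undirected_tree_no_ear:
  assumes "undirected_tree T" "X \<subseteq> pverts T" "x \<in> pverts T" "x \<notin> X"
    and "(a, x) \<in> parcs T" "(b, x) \<in> parcs T" "a \<in> X" "b \<in> X"
    and reach: "a \<rightarrow>\<^sup>*\<^bsub>with_proj \<lparr>pverts = X, parcs = parcs T \<inter> X \<times> X\<rparr>\<^esub> b"
  shows "a = b"
proof (rule ccontr)
  assume "a \<noteq> b"
  have "pair_graph T" using assms(1) by (simp add: undirected_tree_def)
  then interpret T: pair_graph T .
  interpret X: pair_wf_digraph "\<lparr>pverts = X, parcs = parcs T \<inter> X \<times> X\<rparr>"
    by unfold_locales auto
  obtain p where "X.apath a p b"
    using reach X.reachable_awalk X.apath_awalk_to_apath by blast
  then have p: "set p \<subseteq> parcs T" "set (pawalk_verts a p) \<subseteq> X" "pcas a p b"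
    "distinct (pawalk_verts a p)"
    using X.awalk_verts_in_verts[of a p] by (auto simp: X.apath_def X.awalk_def)
  have "p \<noteq> []" using p \<open>a \<noteq> b\<close> by auto
  have verts: "pawalk_verts a (p @ [(b, x)]) = pawalk_verts a p @ [x]" if "pcas a p b" for a
    using that by (induction p arbitrary: a) auto
  have cas: "pcas a (p @ [(b, x)]) x" if "pcas a p b" for a
    using that by (induction p arbitrary: a) auto
  have "T.cycle ((x, a) # p @ [(b, x)])"
    unfolding T.cycle_def
  proof (intro exI[of _ x] conjI)
    show "T.awalk x ((x, a) # p @ [(b, x)]) x"
      using p assms T.arcs_symmetric cas by (auto simp: T.awalk_def)
    show "distinct (tl (pawalk_verts x ((x, a) # p @ [(b, x)])))"
      using p assms verts by auto
  qed simp
  moreover have "3 \<le> length ((x, a) # p @ [(b, x)])"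
    using \<open>p \<noteq> []\<close> by (cases p) auto
  ultimately show False using assms(1) by (auto simp: undirected_tree_def)
qed

text \<open>The nodes are numbered in a search order. Earlier nodes induce a connected subgraph, so
  by \<open>undirected_tree_no_ear\<close> each later node has a single earlier neighbour, which
  becomes its parent.\<close>

lemma tree_decomposition_order:
  assumes "tree_decomposition G T B"
  obtains p C where "ordered_decomposition p C (parcs G)" "pverts G = (\<Union>i. C i)"
    "\<And>i. C i = {} \<or> (\<exists>t\<in>pverts T. C i = B t)"
proof -
  have tree: "undirected_tree T" and cover: "(\<Union>t\<in>pverts T. B t) = pverts G"
    and edges: "\<And>u v. (u, v) \<in> parcs G \<Longrightarrow> \<exists>t\<in>pverts T. u \<in> B t \<and> v \<in> B t"
    and conn: "\<And>v. v \<in> pverts G \<Longrightarrow> connected (with_proj T \<restriction> {t \<in> pverts T. v \<in> B t})"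
    using assms by (auto simp: tree_decomposition_def)
  have "pair_graph T" "connected (with_proj T)" using tree by (auto simp: undirected_tree_def)
  then interpret T: pair_graph T by simp
  have restrict: "with_proj T \<restriction> pverts T = with_proj T"
    using T.in_arcsD1 T.in_arcsD2 by (auto simp: induce_subgraph_def with_proj_def)
  have T_conn: "(u, v) \<in> (parcs T)\<^sup>*" if "u \<in> pverts T" "v \<in> pverts T" for u v
  proof -
    have "(u, v) \<in> (parcs T \<inter> pverts T \<times> pverts T)\<^sup>*"
      using that \<open>pair_graph T\<close> \<open>connected T\<close> restrict by (intro connected_imp_rtrancl) simp_all
    then show ?thesis using rtrancl_mono[of "parcs T \<inter> pverts T \<times> pverts T" "parcs T"] by blast
  qed
  have T_verts: "pverts T \<noteq> {}"
    using \<open>connected T\<close> unfolding connected_def strongly_connected_def mk_symmetric_def by simp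
  have T_arcs: "parcs T \<subseteq> pverts T \<times> pverts T" using T.in_arcsD1 T.in_arcsD2 by auto
  obtain xs where xs: "distinct xs" "set xs = pverts T"
    and earlier: "\<And>i. 0 < i \<Longrightarrow> i < length xs \<Longrightarrow> \<exists>j<i. (xs ! j, xs ! i) \<in> parcs T"
    using search_order[OF T.pair_finite_verts T_verts T_arcs T_conn] by blast
  have in_T: "xs ! i \<in> pverts T" if "i < length xs" for i
    using nth_mem[OF that] xs(2) by simp

  have unique: "j = k"
    if jk: "j < i" "k < i" "i < length xs" "(xs ! j, xs ! i) \<in> parcs T" "(xs ! k, xs ! i) \<in> parcs T"
    for i j k
  proof -
    define X where "X = (!) xs ` {..<i}"
    define TX where "TX = \<lparr>pverts = X, parcs = parcs T \<inter> X \<times> X\<rparr>"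
    interpret X: pair_sym_digraph TX
      using T.arcs_symmetric by unfold_locales (auto simp: TX_def symmetric_def intro!: symI)
    \<comment> \<open>Earlier neighbours lead back to the first node, so the nodes before
      \<open>i\<close> are connected among themselves.\<close>
    have reach: "xs ! 0 \<rightarrow>\<^sup>*\<^bsub>with_proj TX\<^esub> xs ! l" if "l < i" for l
      using that
    proof (induction l rule: less_induct)
      case (less l)
      show ?case
      proof (cases "l = 0")
        case True
        with less.prems have "xs ! l \<in> pverts TX" by (auto simp: TX_def X_def)
        with True show ?thesis by simp
      next
        case False
        then obtain j where "j < l" "(xs ! j, xs ! l) \<in> parcs T"
          using earlier[of l] less.prems \<open>i < length xs\<close> by auto
        then have "(xs ! j, xs ! l) \<in> parcs TX" using less.prems by (auto simp: TX_def X_def)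
        with less.IH[of j] \<open>j < l\<close> less.prems show ?thesis
          using X.reachable_adj_trans by auto
      qed
    qed
    then have "xs ! j \<rightarrow>\<^sup>*\<^bsub>with_proj TX\<^esub> xs ! k"
      using jk X.reachable_trans symmetric_reachable X.pair_sym_arcs by metis
    moreover have "X \<subseteq> pverts T" "xs ! j \<in> X" "xs ! k \<in> X" using in_T jk by (auto simp: X_def)
    moreover have "xs ! i \<notin> X" using jk xs by (auto simp: X_def nth_eq_iff_index_eq)
    ultimately have "xs ! j = xs ! k"
      using undirected_tree_no_ear[OF tree, of X "xs ! i"] jk in_T by (simp add: TX_def)
    then show ?thesis using jk xs by (simp add: nth_eq_iff_index_eq)
  qed

  \<comment> \<open>Numbers beyond the list become children of \<open>0\<close> with empty bags, so
    that \<open>p i < i\<close> holds for every positive \<open>i\<close>.\<close>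
  define p where "p i = (if 0 < i \<and> i < length xs then SOME j. j < i \<and> (xs ! j, xs ! i) \<in> parcs T else 0)"
    for i
  define C where "C i = (if i < length xs then B (xs ! i) else {})" for i
  have p: "p i < i \<and> (xs ! p i, xs ! i) \<in> parcs T" if "0 < i" "i < length xs" for i
    using someI_ex[OF earlier[OF that]] that by (simp add: p_def)
  interpret parent_order p
    by unfold_locales (metis p p_def)
  have parent: "p i = j" if "j < i" "i < length xs" "(xs ! j, xs ! i) \<in> parcs T" for i j
    using unique[of "p i" i j] p[of i] that by simp

  have "ordered_decomposition p C (parcs G)"
  proof
    fix v i j assume v: "v \<in> C i" "v \<in> C j" "j < i"
    then have ij: "i < length xs" "j < length xs" by (auto simp: C_def split: if_splits)
    define S where "S = {t \<in> pverts T. v \<in> B t}"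
    \<comment> \<open>\<open>X\<close> is the subtree at \<open>i\<close>. A walk through the bags
      of \<open>v\<close> from node \<open>i\<close> to node \<open>j\<close> must leave it, and the
      only arc out leads from \<open>i\<close> to its parent.\<close>
    define X where "X = (!) xs ` {k. k < length xs \<and> anc i k}"
    have "xs ! i \<in> S" "xs ! j \<in> S" using v ij in_T by (auto simp: S_def C_def)
    moreover have "v \<in> pverts G" using \<open>xs ! i \<in> S\<close> cover by (auto simp: S_def)
    ultimately have "(xs ! i, xs ! j) \<in> (parcs T \<inter> S \<times> S)\<^sup>*"
      using conn connected_imp_rtrancl[OF _ \<open>pair_graph T\<close>] by (simp add: S_def)
    moreover have "xs ! i \<in> X" using ij anc_refl by (auto simp: X_def)
    moreover have "xs ! j \<notin> X"
      using ij anc_le \<open>j < i\<close> xs(1) by (fastforce simp: X_def nth_eq_iff_index_eq)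
    ultimately obtain a b where ab: "(a, b) \<in> parcs T" "a \<in> S" "b \<in> S" "a \<in> X" "b \<notin> X"
      by (blast elim: rtrancl_crossing)
    then obtain k where k: "k < length xs" "anc i k" "a = xs ! k" by (auto simp: X_def)
    obtain l where l: "l < length xs" "b = xs ! l"
      using ab xs(2) by (metis (no_types, lifting) S_def in_set_conv_nth mem_Collect_eq)
    have "\<not> anc i l" using ab l by (auto simp: X_def)
    have "\<not> k < l"
    proof
      assume "k < l"
      then have "p l = k" using ab(1) k(3) l by (intro parent) simp_all
      then have "anc i l" using k(2) \<open>k < l\<close> anc_step[of l i] by simp
      with \<open>\<not> anc i l\<close> show False ..
    qed
    moreover have "k \<noteq> l" using ab k l T.no_loops' by blast
    ultimately have "p k = l" using ab k l T.arcs_symmetric by (intro parent) auto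
    from \<open>anc i k\<close> have "k = i"
      by cases (use \<open>p k = l\<close> \<open>\<not> anc i l\<close> in auto)
    with \<open>p k = l\<close> ab l show "v \<in> C (p i)" by (auto simp: S_def C_def)
  next
    fix u v assume "(u, v) \<in> parcs G"
    then obtain t where "t \<in> pverts T" "u \<in> B t" "v \<in> B t" using edges by blast
    moreover from this obtain i where "i < length xs" "xs ! i = t" by (metis in_set_conv_nth xs(2))
    ultimately show "\<exists>i. u \<in> C i \<and> v \<in> C i" by (intro exI[of _ i]) (simp add: C_def)
  qed
  moreover have "pverts G = (\<Union>i. C i)"
  proof -
    have "pverts G = (\<Union>t\<in>set xs. B t)" using cover xs by simp
    also have "\<dots> = (\<Union>i. C i)" by (fastforce simp: C_def in_set_conv_nth split: if_splits)
    finally show ?thesis .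
  qed
  moreover have "C i = {} \<or> (\<exists>t\<in>pverts T. C i = B t)" for i using in_T by (auto simp: C_def)
  ultimately show thesis using that by blast
qed

text \<open>The decomposition with a single bag shows that the \<open>LEAST\<close> in
  \<open>treewidth\<close> ranges over a nonempty set, so it is attained.\<close>

lemma treewidth_decomposition:
  assumes "pair_graph G"
  obtains T :: "nat pair_pre_digraph" and B where
    "tree_decomposition G T B" "decomposition_width T B = treewidth G"
proof -
  define T where "T = \<lparr>pverts = {0 :: nat}, parcs = {}\<rparr>"
  interpret G: pair_graph G by fact
  have "pair_graph T" by unfold_locales (auto simp: T_def symmetric_def sym_def)
  then interpret T: pair_graph T .
  have "connected (with_proj T \<restriction> {0})" "connected (with_proj T)"
    by (auto simp: connected_def strongly_connected_def mk_symmetric_def T_def reachable_def)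
  moreover have "\<not> T.cycle p" for p
  proof -
    have "parcs T = {}" by (simp add: T_def)
    then show ?thesis unfolding T.cycle_def T.awalk_def by auto
  qed
  ultimately have "undirected_tree T"
    using \<open>pair_graph T\<close> by (auto simp: undirected_tree_def)
  moreover have "{t \<in> pverts T. v \<in> pverts G} = {0}" if "v \<in> pverts G" for v
    using that by (auto simp: T_def)
  ultimately have "tree_decomposition G T (\<lambda>_. pverts G)"
    using \<open>connected (with_proj T \<restriction> {0})\<close> G.in_arcsD1 G.in_arcsD2
    by (auto simp: tree_decomposition_def T_def)
  then have "\<exists>w (T :: nat pair_pre_digraph) B.
    tree_decomposition G T B \<and> w = decomposition_width T B" by blast
  from LeastI_ex[OF this] show thesis
    using that unfolding treewidth_def by metis
qed

lemma treewidth_order: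
  assumes "pair_graph G" "treewidth G \<le> k"
  obtains p C where "ordered_decomposition p C (parcs G)" "pverts G = (\<Union>i. C i)"
    "\<And>i. finite (C i) \<and> card (C i) \<le> k + 1"
proof -
  obtain T :: "nat pair_pre_digraph" and B where
    td: "tree_decomposition G T B" and w: "decomposition_width T B = treewidth G"
    using treewidth_decomposition[OF assms(1)] .
  obtain p C where C: "ordered_decomposition p C (parcs G)" "pverts G = (\<Union>i. C i)"
    "\<And>i. C i = {} \<or> (\<exists>t\<in>pverts T. C i = B t)"
    using tree_decomposition_order[OF td] by metis
  have "pair_graph T" using td by (auto simp: tree_decomposition_def undirected_tree_def)
  then interpret T: pair_graph T .
  interpret G: pair_graph G by fact
  have bag: "card (B t) \<le> k + 1" if "t \<in> pverts T" for t
  proof -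
    have "card (B t) \<le> Max ((\<lambda>t. card (B t)) ` pverts T)"
      using that T.pair_finite_verts by (intro Max_ge) auto
    then show ?thesis using w assms(2) by (simp add: decomposition_width_def)
  qed
  have "finite (C i) \<and> card (C i) \<le> k + 1" for i
  proof
    show "finite (C i)" using C(2) G.pair_finite_verts finite_subset[of "C i" "pverts G"] by blast
    show "card (C i) \<le> k + 1" using C(3)[of i] bag by auto
  qed
  with C that show thesis by blast
qed

subsection \<open>Products with graphs of bounded tree-depth\<close>

text \<open>Numbering each fibre of \<open>h\<close> injectively below \<open>m\<close> gives the
  second coordinate. Adjacent vertices of one fibre differ in it and are joined through the complete
  graph; between fibres an arc of \<open>H\<close> suffices, whether or not the numbers
  agree.\<close>

lemma contained_in_strong_product:
  assumes "pair_graph G" "pair_graph H" "h ` pverts G \<subseteq> pverts H"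
    and edge: "\<And>u v. (u, v) \<in> parcs G \<Longrightarrow> h u = h v \<or> (h u, h v) \<in> parcs H"
    and fibre: "\<And>a. card {v \<in> pverts G. h v = a} \<le> m"
  shows "contained_in G (H \<boxtimes> complete_graph m)"
proof -
  interpret G: pair_graph G by fact
  interpret H: pair_graph H by fact
  define f where "f a = (SOME f. f ` {v \<in> pverts G. h v = a} \<subseteq> {..<m} \<and>
    inj_on f {v \<in> pverts G. h v = a})" for a
  have f: "f a ` {v \<in> pverts G. h v = a} \<subseteq> {..<m} \<and> inj_on (f a) {v \<in> pverts G. h v = a}" for a
    unfolding f_def using fibre[of a] G.pair_finite_verts
    by (intro someI_ex[of "\<lambda>f. f ` {v \<in> pverts G. h v = a} \<subseteq> {..<m} \<and>
      inj_on f {v \<in> pverts G. h v = a}"] card_le_inj) auto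
  define g where "g v = (h v, f (h v) v)" for v
  have inj: "inj_on g (pverts G)"
  proof (rule inj_onI)
    fix u v assume "u \<in> pverts G" "v \<in> pverts G" "g u = g v"
    then show "u = v" using f[of "h v"] unfolding g_def inj_on_def by force
  qed
  have less: "f (h v) v < m" if "v \<in> pverts G" for v using f[of "h v"] that by auto
  define S where "S = \<lparr>pverts = g ` pverts G, parcs = map_prod g g ` parcs G\<rparr>"
  define P where "P = H \<boxtimes> complete_graph m"
  have "pair_wf_digraph S" "pair_wf_digraph P"
    using G.in_arcsD1 G.in_arcsD2 by unfold_locales (auto simp: S_def P_def strong_product_def)
  then have wf: "wf_digraph (with_proj S)" "wf_digraph (with_proj P)"
    by (simp_all add: wf_digraph_wp_iff)
  have "pverts S \<subseteq> pverts P"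
    using assms(3) less by (auto simp: S_def P_def strong_product_def complete_graph_def g_def)
  moreover have "parcs S \<subseteq> parcs P"
  proof
    fix e assume "e \<in> parcs S"
    then obtain u v where e: "e = (g u, g v)" "(u, v) \<in> parcs G" by (auto simp: S_def)
    then have uv: "u \<in> pverts G" "v \<in> pverts G" "u \<noteq> v"
      using G.in_arcsD1 G.in_arcsD2 G.no_loops' by blast+
    with inj have "g u \<noteq> g v" by (auto dest: inj_onD)
    with e uv edge[OF e(2)] less assms(3) show "e \<in> parcs P"
      by (auto simp: P_def strong_product_def complete_graph_def g_def)
  qed
  ultimately have "subgraph (with_proj S) (with_proj P)"
    using wf by (simp add: subgraph_def compatible_def)
  moreover have "digraph_iso (with_proj G) (with_proj S)"
    unfolding digraph_iso_def
  proof (intro exI conjI)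
    let ?i = "\<lparr>iso_verts = g, iso_arcs = map_prod g g, iso_head = snd, iso_tail = fst\<rparr>"
    have "inj_on (map_prod g g) (parcs G)"
      using inj G.in_arcsD1 G.in_arcsD2 by (auto simp: inj_on_def)
    then show "G.digraph_isomorphism ?i"
      using inj G.wf_digraph_axioms by (auto simp: G.digraph_isomorphism_def)
    show "with_proj S = app_iso ?i (with_proj G)"
      by (simp add: app_iso_def with_proj_def S_def)
  qed
  ultimately show ?thesis unfolding contained_in_def P_def by blast
qed

lemma pair_graph_forest_closure:
  assumes "finite (pverts F)"
  shows "pair_graph (forest_closure F)"
proof
  show "finite (parcs (forest_closure F))"
    by (rule finite_subset[of _ "pverts F \<times> pverts F"]) (use assms in \<open>auto simp: forest_closure_def\<close>)
qed (use assms in \<open>auto simp: forest_closure_def symmetric_def sym_def\<close>)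

lemma treedepth_forest_closure_le:
  assumes "rooted_forest F"
  shows "treedepth (forest_closure F) \<le> forest_height F"
proof -
  have "pair_digraph F" using assms by (simp add: rooted_forest_def)
  then interpret F: pair_digraph F .
  interpret C: pair_graph "forest_closure F"
    using F.pair_finite_verts by (rule pair_graph_forest_closure)
  have "subgraph (with_proj (forest_closure F)) (with_proj (forest_closure F))"
    using C.wf_digraph_axioms by (simp add: subgraph_def compatible_def)
  with assms show ?thesis unfolding treedepth_def by (intro Least_le) blast
qed

section \<open>Forests of lists under the prefix order\<close>

text \<open>The coding by \<open>to_nat\<close> puts the forest on the vertex type that the theorem
  asks for.\<close>

definition list_forest :: "nat list set \<Rightarrow> nat pair_pre_digraph" where
  "list_forest L = \<lparr>pverts = to_nat ` L,
     parcs = {(to_nat (butlast l), to_nat l) |l. l \<in> L \<and> l \<noteq> []}\<rparr>"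

text \<open>Every arc appends one entry, so list length serves as depth. Both acyclicity and the
  bound on the height come from this.\<close>

lemma list_forest_walk_length:
  fixes u v :: "nat list"
  assumes "pcas (to_nat u) w (to_nat v)" "set w \<subseteq> parcs (list_forest L)"
  shows "length v = length u + length w"
  using assms
proof (induction w arbitrary: u)
  case (Cons e w)
  then have "e \<in> parcs (list_forest L)" by simp
  then obtain l :: "nat list" where "e = (to_nat (butlast l), to_nat l)" "l \<noteq> []"
    by (auto simp: list_forest_def)
  moreover from this Cons have "u = butlast l" "length v = length l + length w" by auto
  ultimately show ?case by (cases l rule: rev_cases) auto
qed simp

lemma length_pawalk_verts: "length (pawalk_verts u w) = Suc (length w)"
  by (induction w arbitrary: u) auto

text \<open>Closure under prefixes keeps parents in \<open>L\<close> and lets a path from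
  \<open>k\<close> to \<open>l\<close> append one entry at a time. A path has at most
  \<open>d\<close> arcs, hence at most \<open>Suc d\<close> vertices.\<close>

lemma list_forest:
  assumes "finite L" and closed: "\<And>k l. l \<in> L \<Longrightarrow> prefix k l \<Longrightarrow> k \<in> L"
  shows "rooted_forest (list_forest L)"
    and "(\<And>l. l \<in> L \<Longrightarrow> length l \<le> d) \<Longrightarrow> forest_height (list_forest L) \<le> Suc d"
    and "k \<in> L \<Longrightarrow> l \<in> L \<Longrightarrow> prefix k l \<Longrightarrow> k \<noteq> l \<Longrightarrow>
      (to_nat k, to_nat l) \<in> parcs (forest_closure (list_forest L))"
proof -
  have butlast_L: "butlast l \<in> L" if "l \<in> L" for l
    using that closed by (metis prefixeq_butlast)
  interpret pair_digraph "list_forest L"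
  proof
    have "parcs (list_forest L) \<subseteq> (\<lambda>l. (to_nat (butlast l), to_nat l)) ` L"
      by (auto simp: list_forest_def)
    then show "finite (parcs (list_forest L))" using assms(1) finite_subset by blast
    show "fst e \<noteq> snd e" if "e \<in> parcs (list_forest L)" for e
      using that by (auto simp: list_forest_def) (metis append_butlast_last_id not_Cons_self2 self_append_conv)
  qed (use assms(1) butlast_L in \<open>auto simp: list_forest_def\<close>)
  have walk: "\<exists>k l. u = to_nat k \<and> v = to_nat l \<and> k \<in> L \<and> l \<in> L \<and> length l = length k + length w"
    if "awalk u w v" for u w v
  proof -
    have "u \<in> pverts (list_forest L)" "v \<in> pverts (list_forest L)"
      using that awalk_hd_in_verts awalk_last_in_verts by blast+
    then obtain k l where "u = to_nat k" "v = to_nat l" "k \<in> L" "l \<in> L"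
      by (auto simp: list_forest_def)
    with that list_forest_walk_length show ?thesis by (auto simp: awalk_def)
  qed
  have "\<not> cycle w" for w
  proof
    assume "cycle w"
    then obtain u where "awalk u w u" "w \<noteq> []" by (auto simp: cycle_def)
    with walk[of u w u] show False by auto
  qed
  moreover have "in_degree (with_proj (list_forest L)) v \<le> 1" for v
  proof -
    have "in_arcs (with_proj (list_forest L)) v \<subseteq> {(to_nat (butlast (from_nat v :: nat list)), v)}"
      by (auto simp: in_arcs_def list_forest_def)
    from card_mono[OF _ this] show ?thesis by (simp add: in_degree_def)
  qed
  ultimately show "rooted_forest (list_forest L)"
    using pair_digraph by (auto simp: rooted_forest_def forest_def)

  show "forest_height (list_forest L) \<le> Suc d" if "\<And>l. l \<in> L \<Longrightarrow> length l \<le> d"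
  proof -
    have bound: "length (pawalk_verts r w) \<le> Suc d" if "apath r w s" for r w s
      using walk[of r w s] that \<open>\<And>l. l \<in> L \<Longrightarrow> length l \<le> d\<close>
      by (force simp: apath_def length_pawalk_verts)
    have Sup: "Sup A \<le> Suc d" if "\<And>a. a \<in> A \<Longrightarrow> a \<le> Suc d" for A :: "nat set"
      using that by (cases "A = {}") (auto intro: cSup_least)
    show ?thesis
      unfolding forest_height_def using bound by (intro Sup) auto
  qed

  show "(to_nat k, to_nat l) \<in> parcs (forest_closure (list_forest L))"
    if "k \<in> L" "l \<in> L" "prefix k l" "k \<noteq> l"
  proof -
    from \<open>prefix k l\<close> obtain z where "l = k @ z" by (auto simp: prefix_def)
    have "to_nat k \<rightarrow>\<^sup>*\<^bsub>with_proj (list_forest L)\<^esub> to_nat (k @ z)" if "k @ z \<in> L" for z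
      using that
    proof (induction z rule: rev_induct)
      case Nil
      then have "to_nat k \<in> pverts (list_forest L)" by (simp add: list_forest_def)
      then show ?case by simp
    next
      case (snoc a z)
      then have "k @ z \<in> L" using closed[of "k @ z @ [a]" "k @ z"] by auto
      moreover have "(to_nat (k @ z), to_nat (k @ z @ [a])) \<in> parcs (list_forest L)"
        using snoc.prems unfolding list_forest_def
        by (force intro: exI[of _ "k @ z @ [a]"] simp: butlast_append)
      ultimately show ?case using snoc.IH reachable_adj_trans by auto
    qed
    with that \<open>l = k @ z\<close> show ?thesis by (auto simp: forest_closure_def list_forest_def)
  qed
qed

text \<open>The labels and all their prefixes form a forest whose closure joins any two distinct
  comparable labels. So each edge of \<open>G\<close> goes to a vertex or an edge of
  \<open>H\<close>.\<close>

lemma list_labelling_contained: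
  fixes f :: "'a \<Rightarrow> nat list"
  assumes "pair_graph G" and len: "\<And>v. v \<in> pverts G \<Longrightarrow> length (f v) \<le> d"
    and fibre: "\<And>a. card {v \<in> pverts G. f v = a} \<le> m"
    and edge: "\<And>u v. (u, v) \<in> parcs G \<Longrightarrow> prefix (f u) (f v) \<or> prefix (f v) (f u)"
  obtains H :: "nat pair_pre_digraph" where "pair_graph H" "treedepth H \<le> Suc d"
    "contained_in G (H \<boxtimes> complete_graph m)"
proof -
  interpret G: pair_graph G by fact
  define L where "L = (\<Union>v\<in>pverts G. set (prefixes (f v)))"
  have fin: "finite L" using G.pair_finite_verts by (auto simp: L_def)
  have closed: "k \<in> L" if "l \<in> L" "prefix k l" for k l
    using that prefix_order.trans by (auto simp: L_def)
  have fL: "f v \<in> L" if "v \<in> pverts G" for v using that by (auto simp: L_def)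
  have lenL: "length l \<le> d" if "l \<in> L" for l
    using that len prefix_length_le by (fastforce simp: L_def)
  define H where "H = forest_closure (list_forest L)"
  have H: "pair_graph H"
    using fin unfolding H_def by (intro pair_graph_forest_closure) (simp add: list_forest_def)
  then interpret H: pair_graph H .
  have "treedepth H \<le> Suc d"
    using treedepth_forest_closure_le[OF list_forest(1)] list_forest(2)[of L d] fin closed lenL
    unfolding H_def by (meson order_trans)
  moreover have "contained_in G (H \<boxtimes> complete_graph m)"
  proof (rule contained_in_strong_product[OF assms(1) H])
    show "(\<lambda>v. to_nat (f v)) ` pverts G \<subseteq> pverts H"
      using fL by (auto simp: H_def forest_closure_def list_forest_def)
    show "to_nat (f u) = to_nat (f v) \<or> (to_nat (f u), to_nat (f v)) \<in> parcs H"
      if "(u, v) \<in> parcs G" for u v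
    proof (cases "f u = f v")
      case False
      have uv: "f u \<in> L" "f v \<in> L" using that fL G.in_arcsD1 G.in_arcsD2 by blast+
      have "(to_nat (f u), to_nat (f v)) \<in> parcs H \<or> (to_nat (f v), to_nat (f u)) \<in> parcs H"
        using edge[OF that] list_forest(3)[OF fin, of "f u" "f v"] list_forest(3)[OF fin, of "f v" "f u"]
          closed uv False unfolding H_def by metis
      then show ?thesis using H.arcs_symmetric by blast
    qed simp
    show "card {v \<in> pverts G. to_nat (f v) = a} \<le> m" for a
    proof -
      have "{v \<in> pverts G. to_nat (f v) = a} \<subseteq> {v \<in> pverts G. f v = from_nat a}" by auto
      from card_mono[OF _ this] fibre[of "from_nat a"] G.pair_finite_verts show ?thesis
        by (auto intro: order_trans)
    qed
  qed
  ultimately show thesis using that H by blast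
qed

section \<open>The real bound and its integer part\<close>

theorem theorem10:
  fixes d k n :: nat and G :: "'a pair_pre_digraph"
  assumes "1 \<le> d"
    and "pair_graph G"
    and "card (pverts G) = n"
    and "treewidth G \<le> k"
  shows "\<exists>(H :: nat pair_pre_digraph) (m :: nat).
    pair_graph H \<and> treedepth H \<le> d \<and>
    real m \<le> (real k + 1) powr (1 - 1 / real d) * real n powr (1 / real d) \<and>
    contained_in G (H \<boxtimes> complete_graph m)"
proof -
  interpret G: pair_graph G by fact
  \<comment> \<open>\<open>e\<close> bounds the length of labels; a path in the forest of lists has
    one vertex more, which gives \<open>d\<close>.\<close>
  obtain e where d: "d = Suc e" using \<open>1 \<le> d\<close> by (cases d) auto
  define x where "x = (real k + 1) powr (1 - 1 / real d) * real n powr (1 / real d)"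
  have "((real k + 1) powr (1 - 1 / real d)) ^ d = (real k + 1) powr ((1 - 1 / real d) * real d)"
    by (simp add: powr_powr flip: powr_realpow)
  also have "(1 - 1 / real d) * real d = real e" by (simp add: d field_simps)
  also have "(real k + 1) powr real e = (real k + 1) ^ e" by (simp add: powr_realpow)
  finally have k_pow: "((real k + 1) powr (1 - 1 / real d)) ^ d = (real k + 1) ^ e" .
  \<comment> \<open>\<open>powr_realpow\<close> needs a positive base, so \<open>n = 0\<close> is
    separate; there both sides are \<open>0\<close>.\<close>
  have n_pow: "(real n powr (1 / real d)) ^ d = real n"
  proof (cases "n = 0")
    case False
    then have "(real n powr (1 / real d)) ^ d = real n powr (1 / real d * real d)"
      by (simp add: powr_powr flip: powr_realpow)
    then show ?thesis by (simp add: d)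
  qed (simp add: d)
  obtain p C where order: "ordered_decomposition p C (parcs G)" and cover: "pverts G = (\<Union>i. C i)"
    and bag: "\<And>i. finite (C i) \<and> card (C i) \<le> k + 1"
    using treewidth_order[OF assms(2,4)] by blast
  have "x ^ Suc e = real n * (real k + 1) ^ e"
    using k_pow n_pow by (simp only: x_def power_mult_distrib d mult.commute)
  then have size: "card (pverts G) * real (k + 1) ^ e \<le> x ^ Suc e"
    using assms(3) by (simp add: add.commute)
  have "0 < k + 1" "0 \<le> x" "pverts G \<subseteq> (\<Union>i. C i)" using cover by (simp_all add: x_def)
  from ordered_decomposition.list_labelling[OF order bag this(1,2) G.pair_finite_verts this(3) size]
  obtain f :: "'a \<Rightarrow> nat list" where f: "\<And>v. length (f v) \<le> e"
    "\<And>a. card {v \<in> pverts G. f v = a} \<le> x"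
    "\<And>u v. u \<in> pverts G \<Longrightarrow> v \<in> pverts G \<Longrightarrow> (u, v) \<in> parcs G \<Longrightarrow>
      prefix (f u) (f v) \<or> prefix (f v) (f u)"
    by blast
  \<comment> \<open>Fibre sizes are integers, so \<open>x\<close> can be rounded down.\<close>
  define m where "m = nat \<lfloor>x\<rfloor>"
  have "card {v \<in> pverts G. f v = a} \<le> m" for a
    using f(2)[of a] by (simp add: m_def le_nat_floor)
  then obtain H :: "nat pair_pre_digraph" where "pair_graph H" "treedepth H \<le> d"
    "contained_in G (H \<boxtimes> complete_graph m)"
    using list_labelling_contained[OF assms(2), of f e m] f G.in_arcsD1 G.in_arcsD2 d by blast
  moreover have "real m \<le> x" by (simp add: m_def x_def)
  ultimately show ?thesis unfolding x_def by blast
qed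

end
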